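(* Let the integers $A(n)$ and $B(n)$, $n\ge 0$, be defined by \[ \sum_{n\geq 0}A(n)q^n=\frac{f_2^6f_7^6}{f_1^2},\qquad \sum_{n\geq 0}B(n)q^n=\frac{f_1^6f_{14}^4}{f_2^2f_7^2}. \] Then for all integers $n\geq 0$, \begin{align*} A(7n+6)&\equiv 0 \pmod{7},\\ B(7n+4)&\equiv 0 \pmod{7}. \end{align*}
   Context: For a positive integer $k$, $f_k:=(q^k;q^k)_\infty=\prod_{i\geq 1}(1-q^{ki})$, regarded as a formal power series in $q$ with integer coefficients (invertible, since its constant term is $1$). *)

theory Defs
  imports "HOL-Analysis.Infinite_Products" "HOL-Computational_Algebra.Formal_Power_Series"
    "HOL-Number_Theory.Cong"
begin

text \<open>
  The product is indexed from 0, so its factors are \<open>1 - q ^ (k * i)\<close> for \<open>i \<ge> 1\<close>; it converges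
  in the metric topology of formal power series (see \<open>has_prod_eulerf\<close>).
\<close>
definition eulerf :: "nat \<Rightarrow> int fps" where
  "eulerf k = (\<Prod>i. 1 - fps_X ^ (k * Suc i))"

lemma has_prod_eulerf_aux:
  assumes "k > 0"
  shows "\<exists>L. fps_nth L 0 = 1 \<and> (\<lambda>i. 1 - fps_X ^ (k * Suc i) :: int fps) has_prod L"
proof -
  define P :: "nat \<Rightarrow> int fps" where "P m = (\<Prod>i\<le>m. 1 - fps_X ^ (k * Suc i))" for m
  define L where "L = Abs_fps (\<lambda>n. fps_nth (P n) n)"
  have stable: "fps_nth (P m) n = fps_nth (P n) n" if "n \<le> m" for m n
    using that
  proof (induction m rule: dec_induct)
    case (step m)
    have "n < Suc (Suc m)" using step by simp
    also have "\<dots> \<le> k * Suc (Suc m)" using mult_le_mono1[OF Suc_leI[OF assms], of "Suc (Suc m)"] by (simp only: One_nat_def[symmetric] mult_1)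
    finally have lt: "n < k * Suc (Suc m)" .
    define Q :: "int fps" where "Q = fps_X ^ (k * Suc (Suc m))"
    have "P (Suc m) = P m * (1 - Q)"
      unfolding P_def Q_def by (rule prod.atMost_Suc)
    hence "fps_nth (P (Suc m)) n = fps_nth (P m) n - fps_nth (P m * Q) n"
      by (simp only: right_diff_distrib mult_1_right fps_sub_nth)
    also have "\<dots> = fps_nth (P m) n"
      unfolding Q_def fps_X_power_mult_right_nth using lt by (simp only: if_True diff_zero)
    finally show ?case using step by simp
  qed simp
  have lim: "P \<longlonglongrightarrow> L"
  proof (rule tendsto_fpsI)
    fix n
    show "eventually (\<lambda>m. fps_nth (P m) n = fps_nth L n) sequentially"
      using eventually_ge_at_top[of n] 
      by eventually_elim (unfold L_def fps_nth_Abs_fps, rule stable)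
  qed
  have L0: "fps_nth L 0 = 1" using assms by (simp add: L_def P_def)
  hence "L \<noteq> 0" by auto
  have "(\<lambda>i. 1 - fps_X ^ (k * Suc i) :: int fps) has_prod L"
    unfolding has_prod_def raw_has_prod_def add_0_right
    by (intro disjI1 conjI \<open>L \<noteq> 0\<close> lim[unfolded P_def])
  with L0 show ?thesis by blast
qed

lemma has_prod_eulerf:
  assumes "k > 0"
  shows "(\<lambda>i. 1 - fps_X ^ (k * Suc i)) has_prod eulerf k"
  proof -
  obtain L where L: "(\<lambda>i. 1 - fps_X ^ (k * Suc i) :: int fps) has_prod L"
    using has_prod_eulerf_aux[OF assms] by blast
  have "eulerf k = L"
    unfolding eulerf_def by (rule has_prod_unique[OF L, symmetric])
  with L show ?thesis by (simp only:)
qed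

lemma eulerf_nth_0:
  assumes "k > 0"
  shows "fps_nth (eulerf k) 0 = 1"
proof -
  obtain L where "fps_nth L 0 = 1" and L: "(\<lambda>i. 1 - fps_X ^ (k * Suc i) :: int fps) has_prod L"
    using has_prod_eulerf_aux[OF assms] by blast
  moreover have "eulerf k = L"
    by (rule has_prod_unique2[OF has_prod_eulerf[OF assms] L])
  ultimately show ?thesis by (simp only:)
qed

text \<open>
  Type \<^typ>\<open>int\<close> is not in class \<^class>\<open>inverse\<close>, so \<open>/\<close> is not available on \<^typ>\<open>int fps\<close>. The
  second argument of \<^term>\<open>fps_right_inverse\<close> is the inverse of the constant term of the divisor.
\<close>
definition fps_quot :: "int fps \<Rightarrow> int fps \<Rightarrow> int fps" where
  "fps_quot f g = f * fps_right_inverse g 1"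

lemma fps_quot_mult: "fps_nth g 0 = 1 \<Longrightarrow> fps_quot f g * g = f"
  using fps_right_inverse[of g 1] by (simp add: fps_quot_def mult.assoc mult.commute[of _ g])

end

theory Submission
  imports Defs "HOL-Computational_Algebra.Polynomial"
begin

text \<open>
  Write \<open>f_k\<close> for \<open>eulerf k\<close>. Since \<open>(1 - x)^7\<close> and \<open>1 - x^7\<close> agree modulo 7, so do \<open>f_d^7\<close> and
  \<open>f_{7d}\<close> (\<open>eulerf_power_7\<close>). Series in \<open>q^7\<close> such as \<open>f_7\<close> and \<open>f_14\<close> do not mix the residue classes of the
  indices modulo 7, so up to such factors the two generating functions can be replaced by
  \<open>(f_1^2 / f_2) * f_1^3\<close> and \<open>(f_2^2 / f_1) * f_2^3\<close>.

  Each of these is a product of two theta series: \<open>f_1^2 / f_2 = \<Sum>(-1)^j q^(j^2)\<close> and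
  \<open>2 f_2^2 / f_1 = \<Sum>q^(j(j+1)/2)\<close> by Gauss (\<open>gauss_phi_tendsto\<close>, \<open>gauss_psi_tendsto\<close>) and
  \<open>2 f_d^3 = \<Sum>(-1)^l (2l+1) q^(d l(l+1)/2)\<close> by Jacobi (\<open>jacobi_cube_tendsto\<close>), all sums being over the
  integers. If \<open>N\<close> is the exponent of a term of the product, then \<open>8N + 1 = 8 j^2 + (2l+1)^2\<close> in the first case
  and \<open>8N + 3 = (2j+1)^2 + 2 (2l+1)^2\<close> in the second. For \<open>N\<close> in the class of 6, respectively 4, the left-hand
  side is divisible by 7. As neither \<open>-1\<close> nor \<open>-2\<close> is a square modulo 7, this forces 7 to divide \<open>2l+1\<close>, which is a
  factor of the coefficient of the term. So every term in question vanishes modulo 7.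

  The three theta identities are limits of specialisations of a finite form of the Jacobi triple
  product (\<open>finite_triple_product\<close>), in which Gaussian binomial coefficients take the place of \<open>1 / f_d\<close>.
  The limit is controlled by congruences modulo powers of \<open>q\<close>, the variable of the power series.
\<close>

section \<open>Congruence modulo an element of a ring\<close>

text \<open>
The ring in question is that of formal power series over the integers, which has no division with
remainder, so congruence is expressed by divisibility. The modulus is a power of \<open>X\<close> or the number 7.
\<close>
definition eqmod :: "'a::comm_ring_1 \<Rightarrow> 'a \<Rightarrow> 'a \<Rightarrow> bool" where
  "eqmod m a b \<longleftrightarrow> m dvd a - b"

lemma eqmod_refl [simp]: "eqmod m a a"
  by (simp add: eqmod_def)

lemma eqmod_sym: "eqmod m a b \<Longrightarrow> eqmod m b a"
  unfolding eqmod_def by (subst dvd_minus_iff[symmetric]) simp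

lemma eqmod_trans [trans]: "eqmod m a b \<Longrightarrow> eqmod m b c \<Longrightarrow> eqmod m a c"
  unfolding eqmod_def using dvd_add by fastforce

lemma eqmod_mult:
  assumes "eqmod m a a'" "eqmod m b b'"
  shows "eqmod m (a * b) (a' * b')"
proof -
  have "a * b - a' * b' = (a - a') * b + a' * (b - b')"
    by (simp add: algebra_simps)
  thus ?thesis using assms by (simp add: eqmod_def)
qed

lemma eqmod_power: "eqmod m a b \<Longrightarrow> eqmod m (a ^ k) (b ^ k)"
  by (induction k) (auto intro: eqmod_mult)

lemma eqmod_prod: "(\<And>i. i \<in> I \<Longrightarrow> eqmod m (f i) (g i)) \<Longrightarrow> eqmod m (prod f I) (prod g I)"
  by (induction I rule: infinite_finite_induct) (auto intro: eqmod_mult)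

lemma eqmod_sum: "(\<And>i. i \<in> I \<Longrightarrow> eqmod m (f i) (g i)) \<Longrightarrow> eqmod m (sum f I) (sum g I)"
  unfolding eqmod_def sum_subtractf[symmetric] by (rule dvd_sum)

lemma eqmod_dvd_mono: "eqmod m a b \<Longrightarrow> k dvd m \<Longrightarrow> eqmod k a b"
  unfolding eqmod_def by (rule dvd_trans)

lemma eqmod_cancel_unit:
  assumes "eqmod m (u * a) (u * b)" and "v * u = 1"
  shows "eqmod m a b"
  using eqmod_mult[OF eqmod_refl[of m v] assms(1)] assms(2)
  by (simp flip: mult.assoc)

lemma X_power_dvd_iff:
  fixes f :: "'a::comm_ring_1 fps"
  shows "fps_X ^ n dvd f \<longleftrightarrow> (\<forall>i<n. fps_nth f i = 0)"
proof
  assume "\<forall>i<n. fps_nth f i = 0"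
  hence "f = fps_shift n f * fps_X ^ n"
    by (intro fps_ext) (simp add: fps_X_power_mult_right_nth)
  thus "fps_X ^ n dvd f" by (metis dvd_triv_right)
qed (auto simp: dvd_def fps_X_power_mult_nth)

lemma eqmod_X_power_iff:
  fixes f g :: "'a::comm_ring_1 fps"
  shows "eqmod (fps_X ^ n) f g \<longleftrightarrow> (\<forall>i<n. fps_nth f i = fps_nth g i)"
  by (simp add: eqmod_def X_power_dvd_iff)

lemma numeral_dvd_fps_iff:
  fixes f :: "int fps"
  shows "numeral w dvd f \<longleftrightarrow> (\<forall>i. numeral w dvd fps_nth f i)"
proof
  assume "\<forall>i. numeral w dvd fps_nth f i"
  hence "f = numeral w * Abs_fps (\<lambda>i. fps_nth f i div numeral w)"
    by (intro fps_ext) (simp add: numeral_fps_const)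
  thus "numeral w dvd f" by (rule dvdI)
qed (auto simp: dvd_def numeral_fps_const)

section \<open>Finite Euler products\<close>

definition qfact :: "'a::comm_ring_1 \<Rightarrow> nat \<Rightarrow> 'a" where
  "qfact q n = (\<Prod>i<n. 1 - q ^ Suc i)"

lemma qfact_0 [simp]: "qfact q 0 = 1"
  and qfact_Suc: "qfact q (Suc n) = qfact q n * (1 - q ^ Suc n)"
  by (simp_all add: qfact_def)

lemma qfact_tendsto_eulerf:
  assumes "d > 0"
  shows "qfact (fps_X ^ d) \<longlonglongrightarrow> eulerf d"
  using has_prod_imp_tendsto'[OF has_prod_eulerf[OF assms]]
  by (simp only: qfact_def[abs_def] power_mult)

lemma qfact_stable:
  fixes q :: "'a::comm_ring_1"
  assumes "n \<le> m"
  shows "eqmod (q ^ Suc n) (qfact q m) (qfact q n)"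
  using assms
proof (induction m rule: dec_induct)
  case (step m)
  have "eqmod (q ^ Suc n) (1 - q ^ Suc m) 1"
    using step(1) by (simp add: eqmod_def le_imp_power_dvd del: power_Suc)
  with step(3) show ?case
    using eqmod_mult by (fastforce simp: qfact_Suc simp del: power_Suc)
qed simp

text \<open>
The factors of the infinite product beyond the \<open>n\<close>-th are congruent to 1 modulo \<open>X ^ Suc n\<close>. This
turns every question about a fixed coefficient of \<open>eulerf d\<close> into one about a finite product.
\<close>
lemma eulerf_eqmod_qfact:
  assumes "d > 0" 
  shows "eqmod (fps_X ^ Suc n) (eulerf d) (qfact (fps_X ^ d) n)"
  unfolding eqmod_X_power_iff
proof safe
  fix i assume i: "i < Suc n"
  have "eventually (\<lambda>m. fps_nth (qfact (fps_X ^ d) m) i = fps_nth (eulerf d) i) sequentially"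
    using qfact_tendsto_eulerf[OF assms] by (simp add: tendsto_fps_iff)
  from eventually_happens[OF eventually_conj[OF this eventually_ge_at_top[of n]]]
  obtain m where m: "fps_nth (qfact (fps_X ^ d) m) i = fps_nth (eulerf d) i" "m \<ge> n"
    by auto
  have "fps_X ^ Suc n dvd ((fps_X ^ d) ^ Suc n :: int fps)"
    unfolding power_mult[symmetric] by (rule le_imp_power_dvd) (use assms in \<open>cases d; simp\<close>)
  from eqmod_dvd_mono[OF qfact_stable[OF m(2)] this]
  have "fps_nth (qfact (fps_X ^ d) m) i = fps_nth (qfact (fps_X ^ d) n :: int fps) i"
    using i unfolding eqmod_X_power_iff by blast
  with m show "fps_nth (eulerf d) i = fps_nth (qfact (fps_X ^ d) n) i" by simp
qed

lemma eulerf_unit: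
  assumes "d > 0"
  obtains v where "v * eulerf d = 1"
  using fps_right_inverse[of "eulerf d" 1] eulerf_nth_0[OF assms] by (metis mult.commute mult_1)

section \<open>Gaussian binomial coefficients\<close>

text \<open>
The recursion is one of the two Pascal rules. It defines \<open>qbin\<close> over every commutative ring, with no
quotient of \<open>q\<close>-factorials; the quotient formula is \<open>qbin_mult_qfact\<close>.
\<close>
fun qbin :: "'a::comm_ring_1 \<Rightarrow> nat \<Rightarrow> nat \<Rightarrow> 'a" where
  "qbin q n 0 = 1"
| "qbin q 0 (Suc k) = 0"
| "qbin q (Suc n) (Suc k) = qbin q n k + q ^ Suc k * qbin q n (Suc k)"

lemma qbin_eq_0: "n < k \<Longrightarrow> qbin q n k = 0"
  by (induction q n k rule: qbin.induct) auto

text \<open>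
The second Pascal rule. The triple product needs both: the first one to add a factor
\<open>b + a * q ^ i\<close>, this one to add a factor \<open>a + b * q ^ Suc i\<close>.
\<close>
lemma qbin_Suc_Suc':
  "k \<le> n \<Longrightarrow> qbin q (Suc n) (Suc k) = q ^ (n - k) * qbin q n k + qbin q n (Suc k)"
proof (induction n arbitrary: k)
  case (Suc n)
  show ?case
  proof (cases k)
    case 0
    thus ?thesis using Suc.IH[of 0] by (simp add: algebra_simps)
  next
    case (Suc l)
    show ?thesis
    proof (cases "l = n")
      case True
      thus ?thesis by (simp add: Suc qbin_eq_0)
    next
      case False
      with Suc Suc.prems have l: "l < n" by simp
      hence e: "n - l = Suc (n - Suc l)" by simp
      have 1: "qbin q (Suc n) (Suc l) = q ^ (n - l) * qbin q n l + qbin q n (Suc l)"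
       and 2: "qbin q (Suc n) (Suc (Suc l)) = q ^ (n - Suc l) * qbin q n (Suc l) + qbin q n (Suc (Suc l))"
        using Suc.IH[of l] Suc.IH[of "Suc l"] l by simp_all
      have "qbin q (Suc (Suc n)) (Suc k)
          = qbin q (Suc n) (Suc l) + q ^ Suc k * qbin q (Suc n) (Suc (Suc l))"
        by (simp add: Suc)
      also have "\<dots> = q ^ (n - l) * (qbin q n l + q ^ Suc l * qbin q n (Suc l))
          + (qbin q n (Suc l) + q ^ Suc (Suc l) * qbin q n (Suc (Suc l)))"
        unfolding 1 2 Suc e by (simp add: algebra_simps)
      also have "\<dots> = q ^ (Suc n - k) * qbin q (Suc n) k + qbin q (Suc n) (Suc k)"
        by (simp add: Suc)
      finally show ?thesis .
    qed
  qed
qed simp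

lemma qbin_mult_qfact: "qbin q (k + l) k * qfact q k * qfact q l = qfact q (k + l)"
proof (induction "k + l" arbitrary: k l)
  case (Suc N)
  show ?case
  proof (cases k)
    case (Suc k')
    note k = this
    show ?thesis
    proof (cases l)
      case 0
      have "qbin q k k = 1" for k by (induction k) (auto simp: qbin_eq_0)
      thus ?thesis using 0 by simp
    next
      case (Suc l')
      have IH: "qbin q (k' + l) k' * qfact q k' * qfact q l = qfact q (k' + l)"
        "qbin q (k + l') k * qfact q k * qfact q l' = qfact q (k + l')"
        using Suc.hyps(1)[of k' l] Suc.hyps(1)[of k l'] Suc.hyps(2) k Suc by simp_all
      have e: "k + l' = k' + l" using k Suc by simp
      have "qbin q (k + l) k * qfact q k * qfact q l =
         (1 - q ^ k) * (qbin q (k' + l) k' * qfact q k' * qfact q l) +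
         q ^ k * (1 - q ^ l) * (qbin q (k + l') k * qfact q k * qfact q l')"
        using k Suc by (simp add: qfact_Suc algebra_simps)
      also have "\<dots> = qfact q (k' + l) * (1 - q ^ (k + l))"
        unfolding IH unfolding e by (simp add: algebra_simps power_add)
      also have "\<dots> = qfact q (k + l)"
        using k Suc by (simp add: qfact_Suc)
      finally show ?thesis .
    qed
  qed simp
qed simp

text \<open>
Modulo \<open>X ^ Suc (min k l)\<close> the three \<open>q\<close>-factorials in \<open>qbin_mult_qfact\<close> all agree with \<open>eulerf d\<close>,
so the binomial coefficient times \<open>eulerf d ^ 2\<close> is \<open>eulerf d\<close>, and one factor cancels.
\<close>
lemma eulerf_mult_qbin:
  assumes "d > 0"
  shows "eqmod (fps_X ^ Suc (min k l)) (eulerf d * qbin (fps_X ^ d) (k + l) k) 1"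
proof -
  obtain v where v: "v * eulerf d = 1" using eulerf_unit[OF assms] .
  define E where "E = eulerf d"
  define B :: "int fps" where "B = qbin (fps_X ^ d) (k + l) k"
  define M :: "int fps" where "M = fps_X ^ Suc (min k l)"
  have E: "eqmod M E (qfact (fps_X ^ d) n)" if "min k l \<le> n" for n
    unfolding E_def M_def
    by (rule eqmod_dvd_mono[OF eulerf_eqmod_qfact[OF assms] le_imp_power_dvd]) (use that in simp)
  have "eqmod M (B * E * E) (B * qfact (fps_X ^ d) k * qfact (fps_X ^ d) l)"
    by (intro eqmod_mult E eqmod_refl) auto
  also have "B * qfact (fps_X ^ d) k * qfact (fps_X ^ d) l = qfact (fps_X ^ d) (k + l)"
    unfolding B_def by (rule qbin_mult_qfact)
  also have "eqmod M \<dots> E" by (intro eqmod_sym[OF E]) auto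
  finally have "eqmod M (E * (E * B)) (E * 1)" by (simp add: mult_ac)
  thus ?thesis using v unfolding B_def E_def M_def by (rule eqmod_cancel_unit)
qed

section \<open>The finite Jacobi triple product\<close>

definition tri :: "int \<Rightarrow> nat" where
  "tri j = nat (j * (j + 1) div 2)"

lemma two_tri: "2 * int (tri j) = j * (j + 1)"
proof -
  have "j * (j + 1) \<ge> 0"
    by (cases "j \<ge> 0") (auto simp: zero_le_mult_iff)
  thus ?thesis by (simp add: tri_def)
qed

lemma tri_succ: "int (tri (j + 1)) = int (tri j) + j + 1"
  using two_tri[of j] two_tri[of "j + 1"] by (simp add: algebra_simps)

text \<open>
Completing the square. This turns an equation between exponents of theta series into one between
values of a diagonal quadratic form.
\<close>
lemma odd_square_tri: "(2 * j + 1)\<^sup>2 = 8 * int (tri j) + 1"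
  using two_tri[of j] by (simp add: power2_eq_square algebra_simps)

text \<open>
The index \<open>j\<close> of a theta series enters the error term in \<open>eulerf_mult_qbin_sum\<close>; this bound says that
the exponent \<open>tri j\<close> grows fast enough to compensate for it.
\<close>
lemma abs_le_tri: "\<bar>j\<bar> \<le> int (tri j) + 1"
proof -
  have "\<bar>j\<bar> * 2 \<le> j * (j + 1) + 2"
  proof (cases "j \<ge> 0")
    case True
    have "j * (j - 1) \<ge> 0" using True by (cases "j = 0") auto
    thus ?thesis using True by (simp add: algebra_simps)
  next
    case False
    have "(j + 1) * (j + 2) \<ge> 0" using False by (cases "j = -1") (auto simp: zero_le_mult_iff)
    thus ?thesis using False by (simp add: algebra_simps)
  qed
  thus ?thesis using two_tri[of j] by simp
qed

text \<open>
Gauss's \<open>q\<close>-binomial theorem, with the sum written so that adding a factor \<open>b + a * q ^ n\<close> shifts the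
argument of \<open>tri\<close> by one. It is the start of the induction in \<open>finite_triple_product\<close>.
\<close>
lemma finite_triple_product_half:
  fixes a b q :: "'a::comm_ring_1"
  shows "(\<Prod>i<n. b + a * q ^ i) =
    (\<Sum>k\<le>n. qbin q n k * (a ^ (n - k) * b ^ k * q ^ tri (int k - int n)))"
proof (induction n)
  case (Suc n)
  define e where "e k = tri (int k - int n)" for k
  have e_Suc: "n + e (Suc k) = Suc k + e k" for k
    using tri_succ[of "int k - int n"] by (simp add: e_def algebra_simps)
  have e0: "tri (- 1 - int n) = n + e 0"
    using tri_succ[of "- 1 - int n"] by (simp add: e_def)
  define t where "t k = qbin q n k * (a ^ (n - k) * b ^ k * q ^ e k)" for k
  define t' where "t' k = qbin q n k * (a ^ (Suc n - k) * b ^ k * q ^ (n + e k))" for k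
  have "a * q ^ n * t k = t' k" if "k \<le> n" for k
    using that by (simp add: t_def t'_def Suc_diff_le power_add mult_ac)
  hence "a * q ^ n * (\<Sum>k\<le>n. t k) = (\<Sum>k\<le>n. t' k)"
    by (simp add: sum_distrib_left)
  also have "\<dots> = (\<Sum>k\<le>Suc n. t' k)"
    by (simp add: t'_def qbin_eq_0)
  also have "\<dots> = t' 0 + (\<Sum>k\<le>n. t' (Suc k))"
    by (rule sum.atMost_Suc_shift)
  finally have "(\<Prod>i<Suc n. b + a * q ^ i) = t' 0 + (\<Sum>k\<le>n. b * t k + t' (Suc k))"
    using Suc.IH by (simp add: t_def e_def algebra_simps sum.distrib sum_distrib_left)
  also have "(\<Sum>k\<le>n. b * t k + t' (Suc k)) =
      (\<Sum>k\<le>n. qbin q (Suc n) (Suc k) * (a ^ (n - k) * b ^ Suc k * q ^ e k))"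
    by (simp add: t_def t'_def e_Suc power_add algebra_simps)
  also have "t' 0 = qbin q (Suc n) 0 * (a ^ Suc n * b ^ 0 * q ^ tri (- 1 - int n))"
    by (simp add: t'_def e0)
  finally show ?case
    by (simp only: sum.atMost_Suc_shift) (simp add: e_def)
qed (simp add: tri_def)

text \<open>
With \<open>a = 1\<close>, \<open>b = z\<close> and \<open>m = n\<close> this is the finite form of the Jacobi triple product, multiplied by
\<open>z ^ n\<close> to avoid negative powers of \<open>z\<close>. The second variable \<open>a\<close> makes the identity homogeneous, so that
\<open>z = - 1 / X\<close>, which is not a power series, can be replaced by \<open>a = X\<close>, \<open>b = - 1\<close>.
\<close>
theorem finite_triple_product:
  fixes a b q :: "'a::comm_ring_1"
  shows "(\<Prod>i<m. a + b * q ^ Suc i) * (\<Prod>i<n. b + a * q ^ i) =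
    (\<Sum>k\<le>m + n. qbin q (m + n) k * (a ^ (m + n - k) * b ^ k * q ^ tri (int k - int n)))"
proof (induction m)
  case 0
  show ?case using finite_triple_product_half[of b a q n] by simp
next
  case (Suc m)
  define N where "N = m + n"
  define e where "e k = tri (int k - int n)" for k
  have e_Suc: "N - k + e (Suc k) = Suc m + e k" if "k \<le> N" for k
    using tri_succ[of "int k - int n"] that by (simp add: e_def N_def algebra_simps of_nat_diff)
  define t where "t k = qbin q N k * (a ^ (N - k) * b ^ k * q ^ e k)" for k
  define t' where "t' k = qbin q N k * (a ^ (Suc N - k) * b ^ k * q ^ e k)" for k
  have "a * t k = t' k" if "k \<le> N" for k
    using that by (simp add: t_def t'_def Suc_diff_le mult_ac)
  hence "a * (\<Sum>k\<le>N. t k) = (\<Sum>k\<le>N. t' k)"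
    by (simp add: sum_distrib_left)
  also have "\<dots> = (\<Sum>k\<le>Suc N. t' k)"
    by (simp add: t'_def qbin_eq_0)
  also have "\<dots> = t' 0 + (\<Sum>k\<le>N. t' (Suc k))"
    by (rule sum.atMost_Suc_shift)
  finally have shift: "a * (\<Sum>k\<le>N. t k) = t' 0 + (\<Sum>k\<le>N. t' (Suc k))" .
  have "(\<Prod>i<Suc m. a + b * q ^ Suc i) * (\<Prod>i<n. b + a * q ^ i)
      = (a + b * q ^ Suc m) * ((\<Prod>i<m. a + b * q ^ Suc i) * (\<Prod>i<n. b + a * q ^ i))"
    by (simp add: mult_ac)
  also have "\<dots> = (a + b * q ^ Suc m) * (\<Sum>k\<le>N. t k)"
    unfolding Suc.IH by (simp add: t_def e_def N_def)
  also have "\<dots> = t' 0 + (\<Sum>k\<le>N. t' (Suc k) + b * q ^ Suc m * t k)"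
    unfolding distrib_right[of a] shift by (simp only: sum.distrib sum_distrib_left add.assoc)
  also have "(\<Sum>k\<le>N. t' (Suc k) + b * q ^ Suc m * t k) =
      (\<Sum>k\<le>N. qbin q (Suc N) (Suc k) * (a ^ (N - k) * b ^ Suc k * q ^ e (Suc k)))"
  proof (rule sum.cong)
    fix k assume "k \<in> {..N}"
    hence k: "k \<le> N" by simp
    have "q ^ (N - k) * q ^ e (Suc k) = q ^ Suc m * q ^ e k"
      unfolding power_add[symmetric] e_Suc[OF k] ..
    thus "t' (Suc k) + b * q ^ Suc m * t k =
        qbin q (Suc N) (Suc k) * (a ^ (N - k) * b ^ Suc k * q ^ e (Suc k))"
      by (simp add: qbin_Suc_Suc'[OF k] t_def t'_def algebra_simps del: qbin.simps power_Suc)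
         (simp add: mult_ac)
  qed simp
  also have "t' 0 = qbin q (Suc N) 0 * (a ^ Suc N * b ^ 0 * q ^ e 0)"
    by (simp add: t'_def)
  finally show ?case
    by (simp only: add_Suc N_def[symmetric] e_def[symmetric] sum.atMost_Suc_shift)
       (simp only: diff_Suc_Suc diff_zero)
qed

section \<open>Theta series\<close>

text \<open>
The partial sums of a bilateral series. They are kept symmetric because the finite triple product
with \<open>m = n\<close> yields exactly the indices from \<open>- n\<close> to \<open>n\<close>.
\<close>
definition theta_sum :: "(int \<Rightarrow> int) \<Rightarrow> (int \<Rightarrow> nat) \<Rightarrow> nat \<Rightarrow> int fps" where
  "theta_sum c s n = (\<Sum>j\<in>{-int n..int n}. of_int (c j) * fps_X ^ s j)"

lemma theta_sum_eq:
  "theta_sum c s n =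
     (\<Sum>k\<le>2 * n. of_int (c (int k - int n)) * fps_X ^ s (int k - int n))"
  unfolding theta_sum_def
  by (rule sum.reindex_bij_witness[of _ "\<lambda>k. int k - int n" "\<lambda>j. nat (j + int n)"]) auto

text \<open>
Passage to the limit in the finite triple product. The binomial coefficient of index \<open>j = k - n\<close>, times
\<open>eulerf d\<close>, is 1 modulo \<open>X ^ (n - \<bar>j\<bar> + 1)\<close>. Its monomial contributes a further \<open>X ^ s j\<close>, and the bound
on \<open>s\<close> makes the two exponents add up to at least \<open>n\<close>, uniformly in \<open>j\<close>.
\<close>
lemma eulerf_mult_qbin_sum:
  assumes "d > 0" and s: "\<And>j. \<bar>j\<bar> \<le> int (s j) + 1"
  shows "eqmod (fps_X ^ n)
    (eulerf d * (\<Sum>k\<le>2 * n. qbin (fps_X ^ d) (2 * n) k *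
        (of_int (c (int k - int n)) * fps_X ^ s (int k - int n))))
    (theta_sum c s n)"
  unfolding theta_sum_eq sum_distrib_left
proof (rule eqmod_sum)
  fix k assume "k \<in> {..2 * n}"
  hence k: "k + (2 * n - k) = 2 * n" by simp
  define S where "S = s (int k - int n)"
  define r where "r = Suc (min k (2 * n - k))"
  have "n \<le> r + S"
    using s[of "int k - int n"] k unfolding r_def S_def by linarith
  have "fps_X ^ r dvd eulerf d * qbin (fps_X ^ d) (2 * n) k - 1"
    using eulerf_mult_qbin[OF assms(1), of k "2 * n - k"] unfolding k r_def eqmod_def .
  hence "fps_X ^ r * fps_X ^ S dvd
      (eulerf d * qbin (fps_X ^ d) (2 * n) k - 1) * (of_int (c (int k - int n)) * fps_X ^ S)"
    by (intro mult_dvd_mono) auto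
  moreover have "fps_X ^ n dvd (fps_X ^ r * fps_X ^ S :: int fps)"
    unfolding power_add[symmetric] using \<open>n \<le> r + S\<close> by (rule le_imp_power_dvd)
  ultimately have "fps_X ^ n dvd
      (eulerf d * qbin (fps_X ^ d) (2 * n) k - 1) * (of_int (c (int k - int n)) * fps_X ^ S)"
    using dvd_trans by blast
  thus "eqmod (fps_X ^ n)
     (eulerf d * (qbin (fps_X ^ d) (2 * n) k * (of_int (c (int k - int n)) * fps_X ^ s (int k - int n))))
     (of_int (c (int k - int n)) * fps_X ^ s (int k - int n))"
    by (simp add: eqmod_def S_def algebra_simps)
qed

text \<open>
The index \<open>Suc n\<close> reflects that in the products of the theta series the factor for \<open>i = 0\<close> is split off,
which needs a positive number of factors.
\<close>
lemma tendsto_fps_of_eqmod: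
  fixes F :: "'a::comm_ring_1 fps"
  assumes "\<And>n. eqmod (fps_X ^ n) F (G (Suc n))"
  shows "G \<longlonglongrightarrow> F"
proof -
  have "(\<lambda>n. G (Suc n)) \<longlonglongrightarrow> F"
  proof (rule tendsto_fpsI)
    fix i
    show "eventually (\<lambda>n. fps_nth (G (Suc n)) i = fps_nth F i) sequentially"
      using eventually_gt_at_top[of i]
      by eventually_elim (use assms in \<open>simp add: eqmod_X_power_iff\<close>)
  qed
  thus ?thesis by (simp only: filterlim_sequentially_Suc)
qed

lemma prod_one_plus_mult_qfact:
  "(\<Prod>i<n. 1 + q ^ Suc i) * qfact q n = qfact (q\<^sup>2) n"
  unfolding qfact_def prod.distrib[symmetric]
  by (rule prod.cong) (simp_all add: algebra_simps power2_eq_square power_mult_distrib)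

lemma prod_odd_mult_qfact:
  "(\<Prod>i<n. 1 - q ^ (2 * i + 1)) * qfact (q\<^sup>2) n = qfact q (2 * n)"
proof (induction n)
  case (Suc n)
  have e: "(q\<^sup>2) ^ Suc n = q ^ Suc (Suc (2 * n))"
    by (simp add: power_mult[symmetric] flip: power_Suc)
  have "(\<Prod>i<Suc n. 1 - q ^ (2 * i + 1)) * qfact (q\<^sup>2) (Suc n) =
     ((\<Prod>i<n. 1 - q ^ (2 * i + 1)) * qfact (q\<^sup>2) n) * (1 - q ^ Suc (2 * n)) * (1 - q ^ Suc (Suc (2 * n)))"
    unfolding prod.lessThan_Suc qfact_Suc e by (simp only: mult_ac Suc_eq_plus1)
  also have "\<dots> = qfact q (2 * Suc n)"
    unfolding Suc.IH by (simp add: qfact_Suc)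
  finally show ?case .
qed simp

lemma minus_one_power_diff: "(-1) ^ nat \<bar>int k - int n\<bar> = (-1 :: 'a::ring_1) ^ (k + n)"
  by (simp add: minus_one_power_iff even_nat_iff)

text \<open>
Gauss's series for \<open>f_2^2 / f_1\<close>, counted twice because \<open>j\<close> and \<open>- 1 - j\<close> have the same exponent. It is
the triple product at \<open>z = 1\<close>: the factor for \<open>i = 0\<close> of the second product is 2, and the other factors
form two copies of \<open>\<Prod>(1 + q^i) = f_2 / f_1\<close>. Multiplying by \<open>f_1\<close> gives the result.
\<close>
theorem gauss_psi_tendsto:
  assumes "f * eulerf 1 = eulerf 2 ^ 2"
  shows "theta_sum (\<lambda>_. 1) tri \<longlonglongrightarrow> 2 * f"
proof (rule tendsto_fps_of_eqmod)
  fix n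
  define M :: "int fps" where "M = fps_X ^ n"
  define R :: "nat \<Rightarrow> int fps" where "R m = (\<Prod>i<m. 1 + fps_X ^ Suc i)" for m
  obtain v where v: "v * eulerf 1 = 1" using eulerf_unit[of 1] by auto
  have R: "eqmod M (eulerf 1 * R m) (eulerf 2)" if "n \<le> m" for m
  proof -
    have "M dvd fps_X ^ Suc m"
      using that by (simp add: M_def le_imp_power_dvd del: power_Suc)
    hence E: "eqmod M (eulerf d) (qfact (fps_X ^ d) m)" if "d > 0" for d
      using eulerf_eqmod_qfact[OF that] eqmod_dvd_mono by blast
    have "eqmod M (eulerf 1 * R m) (qfact (fps_X ^ 1) m * R m)"
      by (intro eqmod_mult E) auto
    also have "qfact (fps_X ^ 1) m * R m = qfact (fps_X ^ 2) m"
      using prod_one_plus_mult_qfact[of "fps_X :: int fps" m] by (simp add: R_def mult.commute)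
    also have "eqmod M \<dots> (eulerf 2)"
      by (rule eqmod_sym[OF E]) auto
    finally show ?thesis .
  qed
  have "2 * (R (Suc n) * R n) = (\<Prod>i<Suc n. 1 + 1 * fps_X ^ Suc i) * (\<Prod>i<Suc n. 1 + 1 * fps_X ^ i)"
    unfolding prod.lessThan_Suc_shift[of "\<lambda>i. 1 + 1 * fps_X ^ i"]
    by (simp add: R_def mult_ac del: power_Suc prod.lessThan_Suc)
  also have "\<dots> = (\<Sum>k\<le>2 * Suc n. qbin (fps_X ^ 1) (2 * Suc n) k *
        (of_int 1 * fps_X ^ tri (int k - int (Suc n))))"
    unfolding mult_2 finite_triple_product by (simp only: power_one mult_1 power_one_right of_int_1)
  finally have sum: "2 * (R (Suc n) * R n) = \<dots>" .
  have "eqmod (fps_X ^ Suc n) (eulerf 1 * (2 * (R (Suc n) * R n))) (theta_sum (\<lambda>_. 1) tri (Suc n))"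
    unfolding sum by (rule eulerf_mult_qbin_sum) (simp_all add: abs_le_tri)
  hence theta: "eqmod M (eulerf 1 * (2 * (R (Suc n) * R n))) (theta_sum (\<lambda>_. 1) tri (Suc n))"
    unfolding M_def by (rule eqmod_dvd_mono) simp
  have "eqmod M (2 * ((eulerf 1 * R (Suc n)) * (eulerf 1 * R n))) (2 * (eulerf 2 * eulerf 2))"
    by (intro eqmod_mult R eqmod_refl) auto
  also have "2 * (eulerf 2 * eulerf 2) = eulerf 1 * (2 * f)"
    using assms by algebra
  finally have "eqmod M (eulerf 1 * (eulerf 1 * (2 * (R (Suc n) * R n)))) (eulerf 1 * (2 * f))"
    by (simp only: mult_ac)
  from eqmod_trans[OF eqmod_sym[OF eqmod_cancel_unit[OF this v]] theta]
  show "eqmod (fps_X ^ n) (2 * f) (theta_sum (\<lambda>_. 1) tri (Suc n))"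
    unfolding M_def .
qed

text \<open>
Gauss's series \<open>\<Sum>(-1)^j q^(j^2) = f_1^2 / f_2\<close>: the triple product in \<open>q^2\<close> at \<open>z = - 1 / q\<close>. Up to factors that cancel, both products
become \<open>\<Prod>(1 - q^(2i+1)) = f_1 / f_2\<close>, and multiplying by \<open>f_2\<close> gives the result.
\<close>
theorem gauss_phi_tendsto:
  assumes "f * eulerf 2 = eulerf 1 ^ 2"
  shows "theta_sum (\<lambda>j. (-1) ^ nat \<bar>j\<bar>) (\<lambda>j. nat (j\<^sup>2)) \<longlonglongrightarrow> f"
proof (rule tendsto_fps_of_eqmod)
  fix n
  define M :: "int fps" where "M = fps_X ^ n"
  define m where "m = Suc n"
  define D :: "int fps" where "D = (\<Prod>i<m. 1 - fps_X ^ (2 * i + 1))"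
  obtain v where v: "v * eulerf 2 = 1" using eulerf_unit[of 2] by auto
  have E: "eqmod M (eulerf d) (qfact (fps_X ^ d) k)" if "d > 0" "n \<le> k" for d k
    by (rule eqmod_dvd_mono[OF eulerf_eqmod_qfact[OF that(1)]])
       (use that in \<open>simp add: M_def le_imp_power_dvd del: power_Suc\<close>)
  have "eqmod M (eulerf 2 * D) (qfact (fps_X ^ 2) m * D)"
    by (intro eqmod_mult E) (auto simp: m_def)
  also have "qfact (fps_X ^ 2) m * D = qfact (fps_X ^ 1) (2 * m)"
    using prod_odd_mult_qfact[where q = "fps_X :: int fps" and n = m] by (simp add: D_def mult.commute)
  also have "eqmod M \<dots> (eulerf 1)"
    by (rule eqmod_sym[OF E]) (auto simp: m_def)
  finally have ED: "eqmod M (eulerf 2 * D) (eulerf 1)" .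

  have "(-1) ^ m * fps_X ^ m * D\<^sup>2 =
     (\<Prod>i<m. fps_X + (-1) * (fps_X ^ 2) ^ Suc i) * (\<Prod>i<m. (-1) + fps_X * (fps_X ^ 2) ^ i)"
  proof -
    have "(\<Prod>i<m. fps_X + (-1) * (fps_X ^ 2) ^ Suc i) = (\<Prod>i<m. fps_X * (1 - fps_X ^ (2 * i + 1)) :: int fps)"
      by (rule prod.cong) (simp_all add: power_mult[symmetric] algebra_simps power2_eq_square mult_2_right power_add)
    moreover have "(\<Prod>i<m. (-1) + fps_X * (fps_X ^ 2) ^ i) = (\<Prod>i<m. (-1) * (1 - fps_X ^ (2 * i + 1)) :: int fps)"
      by (rule prod.cong) (simp_all add: power_mult[symmetric])
    ultimately show ?thesis
      by (simp only: prod.distrib D_def) (simp add: power2_eq_square mult_ac)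
  qed
  also have "\<dots> = (\<Sum>k\<le>2 * m. qbin (fps_X ^ 2) (2 * m) k *
       (fps_X ^ (2 * m - k) * (- 1) ^ k * (fps_X ^ 2) ^ tri (int k - int m)))"
    unfolding mult_2 by (rule finite_triple_product)
  \<comment> \<open>Every term contains the factor \<open>fps_X ^ m\<close> of the left-hand side, which is then cancelled.\<close>
  also have "\<dots> = (\<Sum>k\<le>2 * m. (-1) ^ m * fps_X ^ m * (qbin (fps_X ^ 2) (2 * m) k *
        (of_int ((-1) ^ nat \<bar>int k - int m\<bar>) * fps_X ^ nat ((int k - int m)\<^sup>2))))"
  proof (rule sum.cong)
    fix k assume k: "k \<in> {..2 * m}"
    have "int (nat (j\<^sup>2)) = j * j" "2 * int (tri j) = j * j + j" for j
      by (simp_all add: power2_eq_square two_tri distrib_left)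
    hence "int (2 * m - k + 2 * tri (int k - int m)) = int (m + nat ((int k - int m)\<^sup>2))"
      using k by (simp add: of_nat_diff del: of_nat_nat)
    hence "fps_X ^ (2 * m - k) * (fps_X ^ 2) ^ tri (int k - int m) =
        fps_X ^ m * fps_X ^ nat ((int k - int m)\<^sup>2)"
      by (simp only: power_mult[symmetric] power_add[symmetric] of_nat_eq_iff)
    moreover have "(-1 :: int fps) ^ m * of_int ((-1) ^ nat \<bar>int k - int m\<bar>) = (-1) ^ k"
      by (simp add: minus_one_power_diff power_add mult_ac flip: power_mult_distrib)
    moreover have "B * (P * S * Q) = s * Y * (B * (c * Z))"
      if "P * Q = Y * Z" "s * c = S" for B P S Q s Y c Z :: "int fps"
      using that by algebra
    ultimately show "qbin (fps_X ^ 2) (2 * m) k *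
       (fps_X ^ (2 * m - k) * (- 1) ^ k * (fps_X ^ 2) ^ tri (int k - int m)) =
       (-1) ^ m * fps_X ^ m * (qbin (fps_X ^ 2) (2 * m) k *
        (of_int ((-1) ^ nat \<bar>int k - int m\<bar>) * fps_X ^ nat ((int k - int m)\<^sup>2)) :: int fps)"
      by blast
  qed simp
  finally have sum: "D\<^sup>2 = (\<Sum>k\<le>2 * m. qbin (fps_X ^ 2) (2 * m) k *
        (of_int ((-1) ^ nat \<bar>int k - int m\<bar>) * fps_X ^ nat ((int k - int m)\<^sup>2)))"
    unfolding sum_distrib_left[symmetric] by simp
  have sq: "\<bar>j\<bar> \<le> int (nat (j\<^sup>2)) + 1" for j
    using abs_le_square_iff[of 1 j] self_le_power[of "\<bar>j\<bar>" 2] by (cases "j = 0") auto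
  have "eqmod (fps_X ^ m) (eulerf 2 * D\<^sup>2) (theta_sum (\<lambda>j. (-1) ^ nat \<bar>j\<bar>) (\<lambda>j. nat (j\<^sup>2)) m)"
    unfolding sum by (rule eulerf_mult_qbin_sum) (simp_all only: sq zero_less_numeral)
  hence theta: "eqmod M (eulerf 2 * D\<^sup>2) (theta_sum (\<lambda>j. (-1) ^ nat \<bar>j\<bar>) (\<lambda>j. nat (j\<^sup>2)) (Suc n))"
    unfolding M_def m_def by (rule eqmod_dvd_mono) simp
  have "eqmod M ((eulerf 2 * D)\<^sup>2) ((eulerf 1)\<^sup>2)"
    by (intro eqmod_power ED)
  also have "(eulerf 1)\<^sup>2 = eulerf 2 * f"
    using assms by algebra
  finally have "eqmod M (eulerf 2 * (eulerf 2 * D\<^sup>2)) (eulerf 2 * f)"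
    by (simp only: power2_eq_square mult_ac)
  from eqmod_trans[OF eqmod_sym[OF eqmod_cancel_unit[OF this v]] theta]
  show "eqmod (fps_X ^ n) f (theta_sum (\<lambda>j. (-1) ^ nat \<bar>j\<bar>) (\<lambda>j. nat (j\<^sup>2)) (Suc n))"
    unfolding M_def .
qed

lemma qbin_const_poly: "qbin [:q:] n k = [:qbin q n k:]"
  by (induction q n k rule: qbin.induct) (auto simp: one_pCons poly_const_pow)

text \<open>
At \<open>z = - 1\<close> the triple product vanishes because of its factor \<open>z + 1\<close>, so the information lies in the
derivative with respect to \<open>z\<close>: the derivative of \<open>(z + 1) * P\<close> at the root is the value of \<open>P\<close> there. For
this the triple product is read in the ring of polynomials in \<open>z\<close>. On the side of the sum, the
derivative gives the weights \<open>k\<close>. Since the sum without weights is zero, they may be changed to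
\<open>2 * (k - m) + 1\<close>, which up to sign is the same for an index \<open>j = k - m\<close> and its mirror image \<open>- 1 - j\<close>.
\<close>
lemma finite_jacobi_identity:
  fixes q :: "'a::idom"
  shows "2 * (qfact q (Suc n) * qfact q n) =
    (\<Sum>k\<le>2 * Suc n. qbin q (2 * Suc n) k *
       (of_int ((-1) ^ nat \<bar>int k - int (Suc n)\<bar> * (2 * (int k - int (Suc n)) + 1)) *
        q ^ tri (int k - int (Suc n))))"
proof -
  define m where "m = Suc n"
  define c where "c k = qbin q (2 * m) k * q ^ tri (int k - int m)" for k
  define P where "P = (\<Prod>i<m. 1 + [:0, 1:] * [:q:] ^ Suc i) * (\<Prod>i<n. [:0, 1:] + [:q:] ^ Suc i)"
  have P: "[:1, 1:] * P = (\<Sum>k\<le>2 * m. monom (c k) k)"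
  proof -
    have h: "[:0, 1:] + [:q:] ^ 0 = [:1, 1:]"
      by (simp add: one_pCons)
    have "[:1, 1:] * P = (\<Prod>i<m. 1 + [:0, 1:] * [:q:] ^ Suc i) * (\<Prod>i<m. [:0, 1:] + 1 * [:q:] ^ i)"
      unfolding P_def m_def prod.lessThan_Suc_shift[of "\<lambda>i. [:0, 1:] + 1 * [:q:] ^ i"]
      by (simp only: mult_1 h mult_ac)
    also have "\<dots> = (\<Sum>k\<le>2 * m. qbin [:q:] (2 * m) k * ([:0, 1:] ^ k * [:q:] ^ tri (int k - int m)))"
      unfolding mult_2 finite_triple_product by (simp only: power_one mult_1)
    also have "\<dots> = (\<Sum>k\<le>2 * m. monom (c k) k)"
      by (rule sum.cong) (simp_all add: c_def qbin_const_poly poly_const_pow monom_altdef mult_ac)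
    finally show ?thesis .
  qed
  have "(\<Sum>k\<le>2 * m. c k * (-1) ^ k) = poly ([:1, 1:] * P) (-1)"
    unfolding P by (simp add: poly_sum poly_monom)
  hence root: "(\<Sum>k\<le>2 * m. c k * (-1) ^ k) = 0" by simp
  have "(\<Sum>k\<le>2 * m. of_nat k * c k * (-1) ^ (k - 1)) = poly (pderiv ([:1, 1:] * P)) (-1)"
    unfolding P by (simp add: poly_sum poly_monom higher_pderiv_sum[of 1, simplified] pderiv_monom)
  also have "\<dots> = poly P (-1)"
    unfolding pderiv_mult by (simp add: pderiv_pCons)
  also have "\<dots> = qfact q m * ((-1) ^ n * qfact q n)"
  proof -
    have "(\<Prod>i<n. - 1 + q ^ Suc i) = (\<Prod>i<n. (-1) * (1 - q ^ Suc i))"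
      by (rule prod.cong) auto
    thus ?thesis
      unfolding prod.distrib by (simp add: P_def poly_prod qfact_def poly_power del: power_Suc)
  qed
  finally have deriv: "(\<Sum>k\<le>2 * m. of_nat k * c k * (-1) ^ (k - 1)) = qfact q m * ((-1) ^ n * qfact q n)" .
  have sgn: "of_nat k * (-1) ^ k = - (of_nat k * (-1 :: 'a) ^ (k - 1))" for k
    by (cases k) auto
  have aux: "B * (s * t * (2 * (K - N) + 1) * T) =
      t * (- 2) * (K * (B * T) * u) + t * (1 - 2 * N) * (B * T * s)"
    if "K * s = - (K * u)" for B s t K N T u :: 'a
    using that by algebra
  have "(\<Sum>k\<le>2 * m. qbin q (2 * m) k *
       (of_int ((-1) ^ nat \<bar>int k - int m\<bar> * (2 * (int k - int m) + 1)) *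
        q ^ tri (int k - int m))) =
     (\<Sum>k\<le>2 * m. (-1) ^ m * (- 2) * (of_nat k * c k * (-1) ^ (k - 1)) +
        (-1) ^ m * (1 - 2 * of_nat m) * (c k * (-1) ^ k))"
  proof (rule sum.cong)
    fix k
    show "qbin q (2 * m) k *
       (of_int ((-1) ^ nat \<bar>int k - int m\<bar> * (2 * (int k - int m) + 1)) *
        q ^ tri (int k - int m)) = 
        (-1) ^ m * (- 2) * (of_nat k * c k * (-1) ^ (k - 1)) +
        (-1) ^ m * (1 - 2 * of_nat m) * (c k * (-1) ^ k)"
      using aux[OF sgn[of k]] unfolding c_def by (simp add: minus_one_power_diff power_add)
  qed simp
  also have "\<dots> = (-1) ^ m * (- 2) * (qfact q m * ((-1) ^ n * qfact q n))"
    unfolding sum.distrib sum_distrib_left[symmetric] root deriv by simp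
  also have "\<dots> = 2 * (qfact q (Suc n) * qfact q n)"
    by (simp add: m_def flip: power_add)
  finally show ?thesis unfolding m_def ..
qed

text \<open>
Jacobi's identity for \<open>f_d^3\<close>. As the bilateral sum counts each exponent twice, it has the limit
\<open>2 * eulerf d ^ 3\<close>.
\<close>
theorem jacobi_cube_tendsto:
  assumes "d > 0"
  shows "theta_sum (\<lambda>j. (-1) ^ nat \<bar>j\<bar> * (2 * j + 1)) (\<lambda>j. d * tri j) \<longlonglongrightarrow> 2 * eulerf d ^ 3"
proof (rule tendsto_fps_of_eqmod)
  fix n
  define M :: "int fps" where "M = fps_X ^ n"
  have E: "eqmod M (eulerf d) (qfact (fps_X ^ d) k)" if "n \<le> k" for k
    by (rule eqmod_dvd_mono[OF eulerf_eqmod_qfact[OF assms]])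
       (use that in \<open>simp add: M_def le_imp_power_dvd del: power_Suc\<close>)
  have s: "\<bar>j\<bar> \<le> int (d * tri j) + 1" for j
  proof -
    have "tri j \<le> d * tri j" using assms by simp
    thus ?thesis using abs_le_tri[of j] by linarith
  qed
  have "eqmod (fps_X ^ Suc n) (eulerf d * (2 * (qfact (fps_X ^ d) (Suc n) * qfact (fps_X ^ d) n)))
     (theta_sum (\<lambda>j. (-1) ^ nat \<bar>j\<bar> * (2 * j + 1)) (\<lambda>j. d * tri j) (Suc n))"
    unfolding finite_jacobi_identity power_mult[symmetric]
    by (rule eulerf_mult_qbin_sum[OF assms s])
  hence theta: "eqmod M (eulerf d * (2 * (qfact (fps_X ^ d) (Suc n) * qfact (fps_X ^ d) n)))
     (theta_sum (\<lambda>j. (-1) ^ nat \<bar>j\<bar> * (2 * j + 1)) (\<lambda>j. d * tri j) (Suc n))"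
    unfolding M_def by (rule eqmod_dvd_mono) simp
  have "eqmod M (eulerf d * (2 * (eulerf d * eulerf d)))
     (eulerf d * (2 * (qfact (fps_X ^ d) (Suc n) * qfact (fps_X ^ d) n)))"
    by (intro eqmod_mult E eqmod_refl) auto
  also note theta
  finally show "eqmod (fps_X ^ n) (2 * eulerf d ^ 3)
     (theta_sum (\<lambda>j. (-1) ^ nat \<bar>j\<bar> * (2 * j + 1)) (\<lambda>j. d * tri j) (Suc n))"
    by (simp add: M_def power3_eq_cube mult_ac)
qed

section \<open>Coefficients in arithmetic progressions\<close>

text \<open>
The series in \<open>X ^ p\<close>. Multiplying by such a series mixes only coefficients whose indices agree
modulo \<open>p\<close>.
\<close>
definition fps_in_powers :: "nat \<Rightarrow> 'a::zero fps \<Rightarrow> bool" where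
  "fps_in_powers p f \<longleftrightarrow> (\<forall>i. \<not> p dvd i \<longrightarrow> fps_nth f i = 0)"

lemma fps_in_powers_mult:
  fixes f g :: "'a::comm_ring_1 fps"
  assumes "fps_in_powers p f" "fps_in_powers p g"
  shows "fps_in_powers p (f * g)"
  unfolding fps_in_powers_def
proof safe
  fix n assume n: "\<not> p dvd n"
  have "fps_nth f i * fps_nth g (n - i) = 0" if "i \<le> n" for i
  proof (cases "p dvd i")
    case True
    hence "\<not> p dvd n - i" using n that by (metis dvd_diffD)
    thus ?thesis using assms(2) by (simp add: fps_in_powers_def)
  qed (use assms(1) in \<open>simp add: fps_in_powers_def\<close>)
  thus "fps_nth (f * g) n = 0" by (simp add: fps_mult_nth)
qed

lemma fps_in_powers_power:
  "fps_in_powers p f \<Longrightarrow> fps_in_powers p (f ^ k :: 'a::comm_ring_1 fps)"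
  by (induction k) (simp_all add: fps_in_powers_mult, simp add: fps_in_powers_def)

lemma fps_in_powers_eulerf:
  assumes "d > 0" "p dvd d"
  shows "fps_in_powers p (eulerf d)"
  unfolding fps_in_powers_def
proof safe
  fix i assume i: "\<not> p dvd i"
  have "fps_in_powers p (qfact (fps_X ^ d) n :: int fps)" for n
  proof (induction n)
    case (Suc n)
    have "fps_in_powers p (1 - fps_X ^ (d * Suc n) :: int fps)"
      using assms(2) by (auto simp: fps_in_powers_def fps_X_power_iff)
    thus ?case unfolding qfact_Suc using Suc.IH
      by (intro fps_in_powers_mult) (simp_all only: power_mult)
  qed (auto simp: fps_in_powers_def)
  moreover have "fps_nth (eulerf d) i = fps_nth (qfact (fps_X ^ d) i) i"
    using eulerf_eqmod_qfact[OF assms(1), of i] unfolding eqmod_X_power_iff by blast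
  ultimately show "fps_nth (eulerf d) i = 0"
    using i by (simp add: fps_in_powers_def)
qed

lemma dvd_nth_mult_in_powers:
  fixes u f :: "'a::comm_ring_1 fps"
  assumes "fps_in_powers p u" and "\<And>m. c dvd fps_nth f (p * m + r)" and "r < p"
  shows "c dvd fps_nth (u * f) (p * n + r)"
  unfolding fps_mult_nth
proof (rule dvd_sum)
  fix i assume "i \<in> {0..p * n + r}"
  hence i: "i \<le> p * n + r" by simp
  show "c dvd fps_nth u i * fps_nth f (p * n + r - i)"
  proof (cases "p dvd i")
    case True
    then obtain k where k: "i = p * k" by auto
    have "p * k < p * Suc n" using i k assms(3) by simp
    hence "k \<le> n" by (simp only: mult_less_cancel1 less_Suc_eq_le)
    hence "p * n + r - i = p * (n - k) + r"
      using k by (simp add: diff_mult_distrib2)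
    thus ?thesis using assms(2)[of "n - k"] by simp
  qed (use assms(1) in \<open>simp add: fps_in_powers_def\<close>)
qed

text \<open>
A converse of \<open>dvd_nth_mult_in_powers\<close>: with constant term 1, the coefficients of \<open>f\<close> in one residue class
can be recovered recursively from those of \<open>u * f\<close> in the same class. It removes unwanted factors
\<open>f_7\<close> and \<open>f_14\<close> without inverting them.
\<close>
lemma dvd_nth_of_mult_in_powers:
  fixes u f :: "'a::comm_ring_1 fps"
  assumes u: "fps_in_powers p u" "fps_nth u 0 = 1"
    and uf: "\<And>m. c dvd fps_nth (u * f) (p * m + r)" and "r < p"
  shows "c dvd fps_nth f (p * n + r)"
proof (induction n rule: less_induct)
  case (less n)
  define N where "N = p * n + r"
  have "c dvd fps_nth u i * fps_nth f (N - i)" if "i \<in> {Suc 0..N}" for i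
  proof (cases "p dvd i")
    case True
    then obtain k where k: "i = p * k" by auto
    have "k > 0" using that k by (cases k) auto
    have "p * k < p * Suc n" using that k assms(4) by (simp add: N_def)
    hence "k \<le> n" by (simp only: mult_less_cancel1 less_Suc_eq_le)
    hence "N - i = p * (n - k) + r"
      using k by (simp add: diff_mult_distrib2 N_def)
    thus ?thesis using less.IH[of "n - k"] \<open>k > 0\<close> \<open>k \<le> n\<close> by simp
  qed (use u in \<open>simp add: fps_in_powers_def\<close>)
  hence "c dvd (\<Sum>i=Suc 0..N. fps_nth u i * fps_nth f (N - i))"
    by (rule dvd_sum)
  moreover have "fps_nth (u * f) N = fps_nth f N + (\<Sum>i=Suc 0..N. fps_nth u i * fps_nth f (N - i))"
    unfolding fps_mult_nth using u(2) by (simp add: sum.atLeast_Suc_atMost)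
  ultimately have "c dvd fps_nth f N"
    using uf[of n] by (simp add: N_def dvd_add_left_iff)
  thus ?case by (simp add: N_def)
qed

text \<open>
In the topology of power series a coefficient of a limit is attained by a partial sum. So the
coefficient of \<open>F * G\<close> at \<open>N\<close> is a finite sum of products \<open>c j * c' l\<close>, and only the pairs \<open>(j, l)\<close> with
total exponent \<open>N\<close> contribute.
\<close>
lemma dvd_nth_theta_mult:
  assumes F: "theta_sum c s \<longlonglongrightarrow> F" and G: "theta_sum c' s' \<longlonglongrightarrow> G"
    and dvd: "\<And>j l. s j + s' l = N \<Longrightarrow> p dvd c j * c' l"
  shows "p dvd fps_nth (F * G) N"
  unfolding fps_mult_nth
proof (rule dvd_sum)
  fix i assume "i \<in> {0..N}"
  have monomial: "fps_nth (of_int a * fps_X ^ m :: int fps) i = (if i = m then a else 0)" for a m i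
    unfolding fps_of_int[symmetric] fps_mult_left_const_nth fps_X_power_nth by simp
  have nth: "fps_nth (theta_sum c s n) i = (\<Sum>j\<in>{-int n..int n}. if i = s j then c j else 0)"
    for c s n i
    unfolding theta_sum_def fps_sum_nth monomial ..
  have attained: "\<exists>n. fps_nth (f n) i = fps_nth g i" if "f \<longlonglongrightarrow> g" for f and g :: "int fps" and i
    by (rule eventually_happens'[OF sequentially_bot]) (use that in \<open>simp add: tendsto_fps_iff\<close>)
  obtain n where n: "fps_nth (theta_sum c s n) i = fps_nth F i"
    using attained[OF F] by blast
  obtain n' where n': "fps_nth (theta_sum c' s' n') (N - i) = fps_nth G (N - i)"
    using attained[OF G] by blast
  have "p dvd fps_nth (theta_sum c s n) i * fps_nth (theta_sum c' s' n') (N - i)"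
    unfolding nth sum_product
    using dvd \<open>i \<in> {0..N}\<close> by (intro dvd_sum) auto
  thus "p dvd fps_nth F i * fps_nth G (N - i)"
    by (simp only: n n')
qed

section \<open>Reduction modulo 7\<close>

text \<open>
The inner binomial coefficients of exponent 7 are divisible by 7; the proof exhibits the quotient.
\<close>
lemma one_minus_power_7:
  "eqmod 7 ((1 - x) ^ 7) (1 - x ^ 7)"
proof -
  have "(1 - x) ^ 7 - (1 - x ^ 7) = 7 * (- x + 3 * x^2 - 5 * x^3 + 5 * x^4 - 3 * x^5 + x^6)"
    by (simp add: algebra_simps eval_nat_numeral)
  thus ?thesis unfolding eqmod_def by (metis dvd_triv_left)
qed

lemma eulerf_power_7:
  assumes "d > 0"
  shows "eqmod 7 (eulerf d ^ 7) (eulerf (7 * d))"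
proof -
  have "7 dvd fps_nth (eulerf d ^ 7) i - fps_nth (eulerf (7 * d)) i" for i
  proof -
    have "eqmod 7 ((\<Prod>j<i. (1 - (fps_X ^ d) ^ Suc j) ^ 7) :: int fps) (\<Prod>j<i. 1 - ((fps_X ^ d) ^ Suc j) ^ 7)"
      by (intro eqmod_prod one_minus_power_7)
    also have "(\<Prod>j<i. (1 - (fps_X ^ d) ^ Suc j) ^ 7) = qfact (fps_X ^ d) i ^ 7"
      unfolding qfact_def prod_power_distrib ..
    also have "(\<Prod>j<i. 1 - ((fps_X ^ d) ^ Suc j) ^ 7) = qfact (fps_X ^ (7 * d)) i"
      unfolding qfact_def power_mult[symmetric] by (simp only: mult_ac)
    finally have "7 dvd fps_nth (qfact (fps_X ^ d) i ^ 7) i - fps_nth (qfact (fps_X ^ (7 * d)) i :: int fps) i"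
      unfolding eqmod_def numeral_dvd_fps_iff by simp
    moreover have "fps_nth (eulerf d ^ 7) i = fps_nth (qfact (fps_X ^ d) i ^ 7) i"
      using eqmod_power[OF eulerf_eqmod_qfact[OF assms, of i], of 7] unfolding eqmod_X_power_iff by blast
    moreover have "fps_nth (eulerf (7 * d)) i = fps_nth (qfact (fps_X ^ (7 * d)) i) i"
      using eulerf_eqmod_qfact[of "7 * d" i] assms unfolding eqmod_X_power_iff by simp
    ultimately show ?thesis by simp
  qed
  thus ?thesis by (simp add: eqmod_def numeral_dvd_fps_iff)
qed

lemma eqmod_7_dvd_nth:
  fixes f g :: "int fps"
  assumes "eqmod 7 f g" "7 dvd fps_nth g i"
  shows "7 dvd fps_nth f i"
proof -
  have "7 dvd fps_nth f i - fps_nth g i"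
    using assms(1) by (simp add: eqmod_def numeral_dvd_fps_iff)
  from dvd_add[OF this assms(2)] show ?thesis by simp
qed

text \<open>
The number \<open>- 1\<close> is not a square modulo 7, so the form is anisotropic there.
\<close>
lemma seven_dvd_square_add_square:
  fixes x y :: int
  assumes "7 dvd y\<^sup>2 + x\<^sup>2" 
  shows "7 dvd x"
proof -
  have "(y mod 7)\<^sup>2 mod 7 = y\<^sup>2 mod 7" "(x mod 7)\<^sup>2 mod 7 = x\<^sup>2 mod 7"
    by (simp_all add: power_mod)
  hence "((y mod 7)\<^sup>2 + (x mod 7)\<^sup>2) mod 7 = 0"
    using assms by (metis dvd_imp_mod_0 mod_add_eq)
  moreover have "y mod 7 \<in> {0,1,2,3,4,5,6}" "x mod 7 \<in> {0,1,2,3,4,5,6}"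
    by auto
  ultimately show ?thesis by auto
qed

text \<open>
The number \<open>- 2\<close> is not a square modulo 7.
\<close>
lemma seven_dvd_square_add_twice_square:
  fixes x y :: int
  assumes "7 dvd y\<^sup>2 + 2 * x\<^sup>2" 
  shows "7 dvd x"
proof -
  have "(y mod 7)\<^sup>2 mod 7 = y\<^sup>2 mod 7" "(2 * (x mod 7)\<^sup>2) mod 7 = (2 * x\<^sup>2) mod 7"
    by (simp_all add: power_mod mod_mult_right_eq[of 2 "x\<^sup>2", symmetric] mod_mult_right_eq[of 2 "(x mod 7)\<^sup>2", symmetric])
  hence "((y mod 7)\<^sup>2 + 2 * (x mod 7)\<^sup>2) mod 7 = 0"
    using assms by (metis dvd_imp_mod_0 mod_add_eq)
  moreover have "y mod 7 \<in> {0,1,2,3,4,5,6}" "x mod 7 \<in> {0,1,2,3,4,5,6}"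
    by auto
  ultimately show ?thesis by auto
qed

text \<open>
A term of the product of the two theta series has an exponent \<open>N = j^2 + tri l\<close>, and
\<open>8 * N + 1 = 8 * j^2 + (2 * l + 1)^2\<close>. For \<open>N = 7 * n + 6\<close> the left-hand side is divisible by 7, which forces
7 to divide \<open>2 * l + 1\<close>, because the right-hand side is a sum of two squares modulo 7. Up to sign,
\<open>2 * l + 1\<close> is the coefficient of the term in Jacobi's series.
\<close>
lemma seven_dvd_phi_jacobi:
  assumes "f * eulerf 2 = eulerf 1 ^ 2"
  shows "7 dvd fps_nth (f * eulerf 1 ^ 3) (7 * n + 6)"
proof -
  have "7 dvd fps_nth (f * (2 * eulerf 1 ^ 3)) (7 * n + 6)"
  proof (rule dvd_nth_theta_mult[OF gauss_phi_tendsto[OF assms] jacobi_cube_tendsto])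
    fix j l assume "nat (j\<^sup>2) + 1 * tri l = 7 * n + 6"
    hence "int (nat (j\<^sup>2) + tri l) = 7 * int n + 6" by simp
    hence "j\<^sup>2 + (2 * l + 1)\<^sup>2 = 7 * (8 * int n + 7 - j\<^sup>2)"
      using odd_square_tri[of l] by simp
    hence "7 dvd j\<^sup>2 + (2 * l + 1)\<^sup>2" by (metis dvd_triv_left)
    hence "7 dvd 2 * l + 1" by (rule seven_dvd_square_add_square)
    thus "7 dvd (-1) ^ nat \<bar>j\<bar> * ((-1) ^ nat \<bar>l\<bar> * (2 * l + 1))"
      by (intro dvd_mult)
  qed simp
  moreover have "fps_nth (f * (2 * eulerf 1 ^ 3)) i = 2 * fps_nth (f * eulerf 1 ^ 3) i" for i
    by (simp add: numeral_fps_const mult.left_commute[of f])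
  moreover have "7 dvd x" if "7 dvd 2 * x" for x :: int
    using that by presburger
  ultimately show ?thesis by metis
qed

text \<open>
Here the exponent is \<open>N = tri j + 2 * tri l\<close>, and \<open>8 * N + 3 = (2 * j + 1)^2 + 2 * (2 * l + 1)^2\<close> is divisible by
7 for \<open>N = 7 * n + 4\<close>.
\<close>
lemma seven_dvd_psi_jacobi:
  assumes "f * eulerf 1 = eulerf 2 ^ 2"
  shows "7 dvd fps_nth (f * eulerf 2 ^ 3) (7 * n + 4)"
proof -
  have eq: "2 * f * (2 * eulerf 2 ^ 3) = 4 * (f * eulerf 2 ^ 3)"
    by (simp add: algebra_simps)
  have "7 dvd fps_nth (2 * f * (2 * eulerf 2 ^ 3)) (7 * n + 4)"
  proof (rule dvd_nth_theta_mult[OF gauss_psi_tendsto[OF assms] jacobi_cube_tendsto])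
    fix j l assume "tri j + 2 * tri l = 7 * n + 4"
    hence "int (tri j + 2 * tri l) = 7 * int n + 4" by simp
    hence "(2 * j + 1)\<^sup>2 + 2 * (2 * l + 1)\<^sup>2 = 7 * (8 * int n + 5)"
      using odd_square_tri[of j] odd_square_tri[of l] by simp
    hence "7 dvd (2 * j + 1)\<^sup>2 + 2 * (2 * l + 1)\<^sup>2" by (metis dvd_triv_left)
    hence "7 dvd 2 * l + 1" by (rule seven_dvd_square_add_twice_square)
    thus "7 dvd 1 * ((-1) ^ nat \<bar>l\<bar> * (2 * l + 1))"
      by (intro dvd_mult)
  qed simp
  moreover have "fps_nth (2 * f * (2 * eulerf 2 ^ 3)) i = 4 * fps_nth (f * eulerf 2 ^ 3) i" for i
    unfolding eq by (simp add: numeral_fps_const)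
  moreover have "7 dvd x" if "7 dvd 4 * x" for x :: int
    using that by presburger
  ultimately show ?thesis by metis
qed

lemma fps_nth_0_eulerf_power: "d > 0 \<Longrightarrow> fps_nth (eulerf d ^ k) 0 = 1"
  by (simp add: fps_nth_power_0 eulerf_nth_0)

text \<open>
Modulo 7, \<open>f_7 * a\<close> is \<open>f_1^7 * a = f_2^6 f_7^6 f_1^5 = f_2^7 f_7^6 * (f_1^2 / f_2) * f_1^3\<close>, and
\<open>f_2^7\<close> is \<open>f_14\<close>. What remains besides series in \<open>X ^ 7\<close> is the product treated in
\<open>seven_dvd_phi_jacobi\<close>.
\<close>
lemma seven_dvd_nth_f2_f7_quot_f1:
  assumes "a * eulerf 1 ^ 2 = eulerf 2 ^ 6 * eulerf 7 ^ 6"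
  shows "7 dvd fps_nth a (7 * n + 6)"
proof -
  define f where "f = fps_quot (eulerf 1 ^ 2) (eulerf 2)"
  have f: "f * eulerf 2 = eulerf 1 ^ 2"
    unfolding f_def by (rule fps_quot_mult) (simp add: eulerf_nth_0)
  have pow: "eqmod 7 (eulerf 1 ^ 7) (eulerf 7)" "eqmod 7 (eulerf 2 ^ 7) (eulerf 14)"
    using eulerf_power_7[of 1] eulerf_power_7[of 2] by simp_all
  have "eqmod 7 (eulerf 7 * a) (eulerf 1 ^ 7 * a)"
    by (intro eqmod_mult eqmod_sym[OF pow(1)] eqmod_refl)
  also have "eulerf 1 ^ 7 * a = eulerf 2 ^ 7 * (eulerf 7 ^ 6 * (f * eulerf 1 ^ 3))"
    using assms f by algebra
  also have "eqmod 7 \<dots> (eulerf 14 * (eulerf 7 ^ 6 * (f * eulerf 1 ^ 3)))"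
    by (intro eqmod_mult pow eqmod_refl)
  finally have cong: "eqmod 7 (eulerf 7 * a) (eulerf 14 * eulerf 7 ^ 6 * (f * eulerf 1 ^ 3))"
    by (simp only: mult.assoc)
  show ?thesis
  proof (rule dvd_nth_of_mult_in_powers[of 7 "eulerf 7"])
    fix m
    have "7 dvd fps_nth (eulerf 14 * eulerf 7 ^ 6 * (f * eulerf 1 ^ 3)) (7 * m + 6)"
      by (intro dvd_nth_mult_in_powers fps_in_powers_mult fps_in_powers_power
            fps_in_powers_eulerf seven_dvd_phi_jacobi f) auto
    thus "7 dvd fps_nth (eulerf 7 * a) (7 * m + 6)"
      by (rule eqmod_7_dvd_nth[OF cong])
  qed (auto intro: fps_in_powers_eulerf simp: eulerf_nth_0)
qed

text \<open>
Modulo 7, \<open>f_14 f_7^2 * b\<close> is \<open>f_2^7 f_7^2 * b = f_2^5 f_1^6 f_14^4 = f_1^7 f_14^4 * (f_2^2 / f_1) * f_2^3\<close>, and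
\<open>f_1^7\<close> is \<open>f_7\<close>.
\<close>
lemma seven_dvd_nth_f1_f14_quot_f2_f7:
  assumes "b * (eulerf 2 ^ 2 * eulerf 7 ^ 2) = eulerf 1 ^ 6 * eulerf 14 ^ 4"
  shows "7 dvd fps_nth b (7 * n + 4)"
proof -
  define f where "f = fps_quot (eulerf 2 ^ 2) (eulerf 1)"
  have f: "f * eulerf 1 = eulerf 2 ^ 2"
    unfolding f_def by (rule fps_quot_mult) (simp add: eulerf_nth_0)
  have pow: "eqmod 7 (eulerf 1 ^ 7) (eulerf 7)" "eqmod 7 (eulerf 2 ^ 7) (eulerf 14)"
    using eulerf_power_7[of 1] eulerf_power_7[of 2] by simp_all
  have "eqmod 7 (eulerf 14 * eulerf 7 ^ 2 * b) (eulerf 2 ^ 7 * eulerf 7 ^ 2 * b)"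
    by (intro eqmod_mult eqmod_sym[OF pow(2)] eqmod_refl)
  also have "eulerf 2 ^ 7 * eulerf 7 ^ 2 * b = eulerf 1 ^ 7 * (eulerf 14 ^ 4 * (f * eulerf 2 ^ 3))"
    using assms f by algebra
  also have "eqmod 7 \<dots> (eulerf 7 * (eulerf 14 ^ 4 * (f * eulerf 2 ^ 3)))"
    by (intro eqmod_mult pow eqmod_refl)
  finally have cong: "eqmod 7 (eulerf 14 * eulerf 7 ^ 2 * b) (eulerf 7 * eulerf 14 ^ 4 * (f * eulerf 2 ^ 3))"
    by (simp only: mult.assoc)
  show ?thesis
  proof (rule dvd_nth_of_mult_in_powers[of 7 "eulerf 14 * eulerf 7 ^ 2"])
    fix m
    have "7 dvd fps_nth (eulerf 7 * eulerf 14 ^ 4 * (f * eulerf 2 ^ 3)) (7 * m + 4)"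
      by (intro dvd_nth_mult_in_powers fps_in_powers_mult fps_in_powers_power
            fps_in_powers_eulerf seven_dvd_psi_jacobi f) auto
    thus "7 dvd fps_nth (eulerf 14 * eulerf 7 ^ 2 * b) (7 * m + 4)"
      by (rule eqmod_7_dvd_nth[OF cong])
  qed (auto intro!: fps_in_powers_mult fps_in_powers_power fps_in_powers_eulerf
            simp: eulerf_nth_0 fps_nth_0_eulerf_power)
qed

theorem theorem6:
  fixes A B :: "nat \<Rightarrow> int"
  assumes "Abs_fps A = fps_quot (eulerf 2 ^ 6 * eulerf 7 ^ 6) (eulerf 1 ^ 2)"
    and "Abs_fps B = fps_quot (eulerf 1 ^ 6 * eulerf 14 ^ 4) (eulerf 2 ^ 2 * eulerf 7 ^ 2)"
  shows "(\<forall>n. [A (7 * n + 6) = 0] (mod 7)) \<and> (\<forall>n. [B (7 * n + 4) = 0] (mod 7))"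
proof -
  have "Abs_fps A * eulerf 1 ^ 2 = eulerf 2 ^ 6 * eulerf 7 ^ 6"
    unfolding assms(1) by (rule fps_quot_mult) (simp add: fps_nth_0_eulerf_power)
  from seven_dvd_nth_f2_f7_quot_f1[OF this] have "7 dvd A (7 * n + 6)" for n by simp
  moreover have "Abs_fps B * (eulerf 2 ^ 2 * eulerf 7 ^ 2) = eulerf 1 ^ 6 * eulerf 14 ^ 4"
    unfolding assms(2) by (rule fps_quot_mult) (simp add: fps_nth_0_eulerf_power)
  from seven_dvd_nth_f1_f14_quot_f2_f7[OF this] have "7 dvd B (7 * n + 4)" for n by simp
  ultimately show ?thesis by (simp add: cong_0_iff)
qed

end
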